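(* For every integer $k\ge 3$, $F(k)\ge \left\lfloor\frac{k+1}{2}\right\rfloor$. Consequently, $\liminf_{k\to\infty}\frac{F(k)}{k}\ge \frac12$.
   Context: A tournament $T=(V,E)$ is a finite directed graph without loops such that for every two distinct vertices $u,v$ exactly one of $uv,vu$ is an arc; write $u\to v$ when $uv\in E$. A set $D\subseteq V$ is a dominating set if for every $y\in V\setminus D$ there is $x\in D$ with $x\to y$; $\gamma(T)$ denotes the minimum size of a dominating set of $T$. For a positive integer $k$, linear orders $P_1,\ldots,P_{2k-1}$ on a finite set $V$ realize the tournament on $V$ in which, for distinct $u,v\in V$, $u\to v$ if and only if $u$ lies above $v$ in at least $k$ of the orders. A tournament realizable in this way by $2k-1$ linear orders is called a $k$-majority tournament. Define $$F(k)=\max\{\gamma(T): T\text{ is a }k\text{-majority tournament}\}.$$ The existence (finiteness) of this maximum for every $k$ is a known theorem of Alon, Brightwell, Kierstead, Kostochka and Winkler. *)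

theory Defs
  imports "Graph_Theory.Pair_Digraph" "HOL-Library.Extended_Real"
begin

locale tournament = pair_digraph T for T :: "'a pair_pre_digraph" +
  assumes exactly_one_arc:
    "\<lbrakk>u \<in> pverts T; v \<in> pverts T; u \<noteq> v\<rbrakk> \<Longrightarrow> (u, v) \<in> parcs T \<longleftrightarrow> (v, u) \<notin> parcs T"

definition dominating_set :: "'a pair_pre_digraph \<Rightarrow> 'a set \<Rightarrow> bool" where
  "dominating_set T D \<longleftrightarrow> D \<subseteq> pverts T \<and> (\<forall>y \<in> pverts T - D. \<exists>x \<in> D. x \<rightarrow>\<^bsub>T\<^esub> y)"

definition domination_number :: "'a pair_pre_digraph \<Rightarrow> nat" where
  "domination_number T = Min {card D | D. dominating_set T D}"

text \<open>
  A pair \<open>(v, u) \<in> P i\<close> is read as \<open>v \<le> u\<close> in the \<open>i\<close>-th order, so for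
  \<open>u \<noteq> v\<close> it says that \<open>u\<close> lies above \<open>v\<close>.
\<close>

definition realizes :: "nat \<Rightarrow> (nat \<Rightarrow> 'a rel) \<Rightarrow> 'a pair_pre_digraph \<Rightarrow> bool" where
  "realizes k P T \<longleftrightarrow>
     (\<forall>i \<in> {1..2 * k - 1}. linear_order_on (pverts T) (P i)) \<and>
     (\<forall>u \<in> pverts T. \<forall>v \<in> pverts T. u \<noteq> v \<longrightarrow>
        (u \<rightarrow>\<^bsub>T\<^esub> v \<longleftrightarrow> k \<le> card {i \<in> {1..2 * k - 1}. (v, u) \<in> P i}))"

definition k_majority_tournament :: "nat \<Rightarrow> 'a pair_pre_digraph \<Rightarrow> bool" where
  "k_majority_tournament k T \<longleftrightarrow> k \<ge> 1 \<and> tournament T \<and> (\<exists>P. realizes k P T)"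

text \<open>
  Every finite tournament is isomorphic to one whose vertices are natural numbers, so
  tournaments on finite sets of natural numbers suffice. The set below is finite for
  every \<open>k\<close> by a theorem of Alon, Brightwell, Kierstead, Kostochka and Winkler, so for
  \<open>k \<ge> 1\<close> the maximum is attained. The value at \<open>k = 0\<close> is irrelevant.
\<close>

definition F :: "nat \<Rightarrow> nat" where
  "F k = Max {domination_number T | T :: nat pair_pre_digraph. k_majority_tournament k T}"

end

theory Submission
  imports Defs "HOL-Library.Product_Lexorder" "HOL-Library.FuncSet"
begin

text \<open>
  Put \<open>s = (k - 1) div 2\<close>, so that \<open>s + 1 = (k + 1) div 2\<close>. It suffices to find a
  \<open>k\<close>-majority tournament in which no \<open>s\<close> vertices dominate, and to show that the domination
  numbers of \<open>k\<close>-majority tournaments are bounded, since otherwise the maximum \<open>F k\<close> would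
  say nothing about an individual tournament.

  For the construction, group \<open>2 * k - 2\<close> of the orders into pairs that are nearly opposite to
  each other, so that most pairs of vertices are tied 1:1 in each pair of orders
  (\<open>paired_orders\<close>). Then \<open>y\<close> beats \<open>x\<close> as soon as \<open>y\<close> wins 2:0 in one pair and loses
  no pair. A vertex has \<open>s\<close> coordinates, each of which governs two pairs of orders: it
  consists of a side, which tells which of its two labels is active, and the two labels. One wins
  a pair by having the active copy of a common label. Given \<open>s\<close> vertices, a vertex \<open>y\<close> that
  beats all of them takes in coordinate \<open>g\<close> the side opposite to the \<open>g\<close>-th given vertex,
  copies that vertex's inactive label as its own active one, and fills its inactive labels with
  values that none of the given vertices has (\<open>small_sets_are_beaten\<close>). Since each coordinate uses 4 orders, \<open>s\<close> is about half of
  \<open>k\<close>.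

  For the boundedness, the arcs of a \<open>k\<close>-majority tournament are covered by transitive
  relations, one for each set of \<open>k\<close> orders, and the number of these colours depends on
  \<open>k\<close> only. Bousquet, Lochet and Thomasse showed that any tournament covered by a given number
  of transitive relations has a dominating set of bounded size. Their argument starts from a
  probability distribution for which every vertex has in-weight at least a constant
  (\<open>fractional_domination\<close>). Splitting the vertices by the colour that carries much of this
  weight and repeating inside the parts, one must meet some colour for a second time, and then
  transitivity allows a bounded number of greedily chosen vertices to dominate the whole part
  (\<open>transitive_bridge\<close>, \<open>domination_with_remembered_colours\<close>).
\<close>

section \<open>Fractional domination\<close>

lemma exists_at_least_weighted_average:
  fixes w f :: "'a \<Rightarrow> real"
  assumes "finite V" and nonneg: "\<And>x. x \<in> V \<Longrightarrow> 0 \<le> w x" and pos: "0 < sum w V"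
    and avg: "r * sum w V \<le> (\<Sum>x\<in>V. w x * f x)"
  shows "\<exists>x\<in>V. r \<le> f x"
proof (rule ccontr)
  assume "\<not> ?thesis"
  then have less: "f x < r" if "x \<in> V" for x
    using that by auto
  obtain z where z: "z \<in> V" "w z > 0"
    using pos by (meson not_less sum_nonpos)
  have "(\<Sum>x\<in>V. w x * f x) < (\<Sum>x\<in>V. w x * r)"
  proof (rule sum_strict_mono_ex1)
    show "\<forall>x\<in>V. w x * f x \<le> w x * r"
      using less nonneg by (simp add: less_imp_le mult_left_mono)
    show "\<exists>x\<in>V. w x * f x < w x * r"
      using z less by (intro bexI[of _ z] mult_strict_left_mono) auto
  qed (fact \<open>finite V\<close>)
  then show False
    using avg by (simp add: sum_distrib_left mult.commute)
qed

text \<open>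
  Averaged over the distribution \<open>p\<close> itself, the out-neighbourhoods have at least half of the
  total weight, because \<open>(x, v)\<close> and \<open>(v, x)\<close> are counted with the same weight
  \<open>p x * p v\<close> and at least one of them is an arc.
\<close>

lemma exists_heavy_out_neighbourhood:
  fixes p :: "'a \<Rightarrow> real"
  assumes "finite V" and nonneg: "\<And>x. x \<in> V \<Longrightarrow> 0 \<le> p x" and pos: "0 < sum p V"
    and total: "\<And>u v. u \<in> V \<Longrightarrow> v \<in> V \<Longrightarrow> R u v \<or> R v u"
  shows "\<exists>x\<in>V. sum p V / 2 \<le> sum p {v \<in> V. R x v}"
proof (rule exists_at_least_weighted_average[OF \<open>finite V\<close> nonneg pos])
  let ?g = "\<lambda>x v. if R x v then p x * p v else 0"
  have eq: "(\<Sum>x\<in>V. p x * sum p {v \<in> V. R x v}) = (\<Sum>x\<in>V. \<Sum>v\<in>V. ?g x v)"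
    using \<open>finite V\<close>
    by (auto simp: sum_distrib_left sum.inter_filter intro!: sum.cong)
  have "sum p V * sum p V = (\<Sum>x\<in>V. \<Sum>v\<in>V. p x * p v)"
    by (simp add: sum_product)
  also have "\<dots> \<le> (\<Sum>x\<in>V. \<Sum>v\<in>V. ?g x v + ?g v x)"
    using total nonneg by (intro sum_mono) (auto simp: mult.commute)
  also have "\<dots> = (\<Sum>x\<in>V. \<Sum>v\<in>V. ?g x v) + (\<Sum>x\<in>V. \<Sum>v\<in>V. ?g v x)"
    by (simp add: sum.distrib)
  also have "(\<Sum>x\<in>V. \<Sum>v\<in>V. ?g v x) = (\<Sum>x\<in>V. \<Sum>v\<in>V. ?g x v)"
    by (rule sum.swap)
  finally show "sum p V / 2 * sum p V \<le> (\<Sum>x\<in>V. p x * sum p {v \<in> V. R x v})"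
    by (simp add: eq)
qed

text \<open>
  The multiplicative weights method: \<open>c u\<close> counts how often \<open>u\<close> has been picked in
  \<open>T\<close> rounds, and a vertex that has been hit \<open>h\<close> times carries weight \<open>(1/2) ^ h\<close>.
  Each round picks a vertex that hits at least half of the current weight, and so removes at
  least a quarter of it.
\<close>

lemma multiplicative_weights:
  fixes V :: "'a set"
  assumes "finite V" "V \<noteq> {}"
    and total: "\<And>u v. u \<in> V \<Longrightarrow> v \<in> V \<Longrightarrow> R u v \<or> R v u"
  shows "\<exists>c :: 'a \<Rightarrow> nat. sum c V = T \<and>
           (\<Sum>v\<in>V. (1/2 :: real) ^ sum c {u \<in> V. R u v}) \<le> card V * (3/4) ^ T"
proof (induction T)
  case 0
  show ?case by (intro exI[of _ "\<lambda>_. 0"]) simp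
next
  case (Suc T)
  then obtain c :: "'a \<Rightarrow> nat" where c: "sum c V = T"
    and bound: "(\<Sum>v\<in>V. (1/2 :: real) ^ sum c {u \<in> V. R u v}) \<le> card V * (3/4) ^ T"
    by blast
  define p where "p v = (1/2 :: real) ^ sum c {u \<in> V. R u v}" for v
  have "0 < sum p V"
    using assms by (intro sum_pos) (auto simp: p_def)
  then obtain x where x: "x \<in> V" and heavy: "sum p V / 2 \<le> sum p {v \<in> V. R x v}"
    using exists_heavy_out_neighbourhood[of V p R] assms by (auto simp: p_def)
  define c' where "c' = c(x := Suc (c x))"
  have c'_eq: "c' = (\<lambda>u. c u + (if u = x then 1 else 0))"
    by (auto simp: c'_def)
  have hits: "sum c' {u \<in> V. R u v} = sum c {u \<in> V. R u v} + (if R x v then 1 else 0)" for v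
    using \<open>finite V\<close> x by (simp add: c'_eq sum.distrib)
  have "(\<Sum>v\<in>V. (1/2 :: real) ^ sum c' {u \<in> V. R u v})
      = (\<Sum>v\<in>V. p v - (if R x v then p v / 2 else 0))"
    by (intro sum.cong) (auto simp: hits p_def)
  also have "\<dots> = sum p V - sum p {v \<in> V. R x v} / 2"
    using \<open>finite V\<close>
    by (auto simp: sum_subtractf sum.inter_filter sum_divide_distrib intro!: sum.cong)
  also have "\<dots> \<le> 3/4 * sum p V"
    using heavy by simp
  also have "\<dots> \<le> card V * (3/4) ^ Suc T"
    using bound by (simp add: p_def)
  finally show ?case
    using c x \<open>finite V\<close>
    by (intro exI[of _ c']) (simp add: c'_eq sum.distrib)
qed

text \<open>
  A cheap substitute for the minimax theorem, which would give 1/2 instead of 1/3. After many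
  rounds of multiplicative weights, a vertex with few hits would alone outweigh the bound on the
  total weight; so the normalised pick counts are the required distribution.
\<close>

lemma fractional_domination:
  assumes "finite V" "V \<noteq> {}"
    and total: "\<And>u v. u \<in> V \<Longrightarrow> v \<in> V \<Longrightarrow> R u v \<or> R v u"
  obtains w :: "'a \<Rightarrow> real" where "\<And>u. 0 \<le> w u" "sum w V = 1"
    "\<And>v. v \<in> V \<Longrightarrow> 1/3 \<le> sum w {u \<in> V. R u v}"
proof -
  have card: "0 < card V"
    using assms by (simp add: card_gt_0_iff)
  \<comment> \<open>With \<open>3 * M\<close> rounds, a vertex hit fewer than \<open>M\<close> times weighs at least
      \<open>(1/2) ^ M\<close>, while the total is at most \<open>card V * (27/64) ^ M\<close>; the quotient of the
      two bases is \<open>27/32 < 1\<close>.\<close>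
  obtain M where M: "(27/32 :: real) ^ M < 1 / card V"
    using real_arch_pow_inv[of "1 / card V" "27/32"] card by auto
  have "M \<noteq> 0"
    using M card by (intro notI) auto
  obtain c :: "'a \<Rightarrow> nat" where c: "sum c V = 3 * M"
    and bound: "(\<Sum>v\<in>V. (1/2 :: real) ^ sum c {u \<in> V. R u v}) \<le> card V * (3/4) ^ (3 * M)"
    using multiplicative_weights[of V R "3 * M"] assms by blast
  have hit: "M \<le> sum c {u \<in> V. R u v}" if "v \<in> V" for v
  proof (rule ccontr)
    assume "\<not> ?thesis"
    then have "(1/2 :: real) ^ M \<le> (1/2) ^ sum c {u \<in> V. R u v}"
      by (intro power_decreasing) auto
    also have "\<dots> \<le> (\<Sum>v\<in>V. (1/2) ^ sum c {u \<in> V. R u v})"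
      using that \<open>finite V\<close> by (intro member_le_sum) auto
    also have "\<dots> \<le> card V * (3/4) ^ (3 * M)"
      by (fact bound)
    also have "(3/4 :: real) ^ (3 * M) = (27/32) ^ M * (1/2) ^ M"
      by (simp add: power_mult power3_eq_cube flip: power_mult_distrib)
    finally have "1 * (1/2 :: real) ^ M \<le> (card V * (27/32) ^ M) * (1/2) ^ M"
      by simp
    then have "1 \<le> card V * (27/32 :: real) ^ M"
      by (subst (asm) mult_le_cancel_right) auto
    then show False
      using M card by (simp add: field_simps)
  qed
  show ?thesis
  proof
    let ?w = "\<lambda>u. real (c u) / (3 * M)"
    show "sum ?w V = 1"
      using c \<open>M \<noteq> 0\<close> by (simp flip: sum_divide_distrib of_nat_sum)
    fix v assume "v \<in> V"
    then have "real M \<le> real (sum c {u \<in> V. R u v})"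
      using hit of_nat_le_iff by blast
    then show "1/3 \<le> sum ?w {u \<in> V. R u v}"
      using \<open>M \<noteq> 0\<close> by (simp add: field_simps flip: sum_divide_distrib)
  qed simp
qed

section \<open>Bounded domination for unions of transitive relations\<close>

text \<open>
  If every vertex of \<open>U\<close> has in-weight at least \<open>\<epsilon>\<close>, then on average a vertex of \<open>V\<close>
  dominates an \<open>\<epsilon>\<close>-fraction of any part of \<open>U\<close>. Picking greedily shrinks the undominated
  part geometrically, at a rate that does not depend on the number of vertices.
\<close>

lemma greedy_partial_domination:
  fixes w \<mu> :: "'a \<Rightarrow> real"
  assumes "finite V" "finite U"
    and w: "\<And>x. x \<in> V \<Longrightarrow> 0 \<le> w x" "sum w V = 1"
    and \<mu>: "\<And>u. u \<in> U \<Longrightarrow> 0 \<le> \<mu> u" "sum \<mu> U = 1"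
    and rich: "\<And>u. u \<in> U \<Longrightarrow> \<epsilon> \<le> sum w {x \<in> V. R x u}" and "\<epsilon> \<le> 1"
  shows "\<exists>A\<subseteq>V. card A \<le> m \<and> sum \<mu> {u \<in> U. \<forall>x\<in>A. \<not> R x u} \<le> (1 - \<epsilon>) ^ m"
proof (induction m)
  case 0
  show ?case by (intro exI[of _ "{}"]) (simp add: \<mu>)
next
  case (Suc m)
  then obtain A where A: "A \<subseteq> V" "card A \<le> m"
    and rest: "sum \<mu> {u \<in> U. \<forall>x\<in>A. \<not> R x u} \<le> (1 - \<epsilon>) ^ m"
    by blast
  define W where "W = {u \<in> U. \<forall>x\<in>A. \<not> R x u}"
  have W: "finite W" "W \<subseteq> U"
    using \<open>finite U\<close> by (auto simp: W_def)
  have "\<epsilon> * sum \<mu> W = (\<Sum>u\<in>W. \<mu> u * \<epsilon>)"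
    by (simp add: sum_distrib_left mult.commute)
  also have "\<dots> \<le> (\<Sum>u\<in>W. \<mu> u * sum w {x \<in> V. R x u})"
    using W rich \<mu> by (intro sum_mono mult_left_mono) auto
  also have "\<dots> = (\<Sum>u\<in>W. \<Sum>x\<in>V. if R x u then w x * \<mu> u else 0)"
    using \<open>finite V\<close>
    by (auto simp: sum_distrib_left sum.inter_filter mult.commute intro!: sum.cong)
  also have "\<dots> = (\<Sum>x\<in>V. \<Sum>u\<in>W. if R x u then w x * \<mu> u else 0)"
    by (rule sum.swap)
  also have "\<dots> = (\<Sum>x\<in>V. w x * sum \<mu> {u \<in> W. R x u})"
    using W by (auto simp: sum_distrib_left sum.inter_filter intro!: sum.cong)
  finally obtain x where x: "x \<in> V" and heavy: "\<epsilon> * sum \<mu> W \<le> sum \<mu> {u \<in> W. R x u}"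
    using exists_at_least_weighted_average[of V w "\<epsilon> * sum \<mu> W" "\<lambda>x. sum \<mu> {u \<in> W. R x u}"]
      \<open>finite V\<close> w by auto
  have split: "sum \<mu> W = sum \<mu> {u \<in> W. R x u} + sum \<mu> {u \<in> W. \<not> R x u}"
    using W by (subst sum.union_disjoint[symmetric]) (auto intro!: sum.cong)
  have eq: "{u \<in> U. \<forall>y\<in>insert x A. \<not> R y u} = {u \<in> W. \<not> R x u}"
    by (auto simp: W_def)
  have "sum \<mu> {u \<in> W. \<not> R x u} \<le> (1 - \<epsilon>) * sum \<mu> W"
    using heavy split by (simp add: algebra_simps)
  also have "\<dots> \<le> (1 - \<epsilon>) * (1 - \<epsilon>) ^ m"
    using rest \<open>\<epsilon> \<le> 1\<close> by (intro mult_left_mono) (simp_all add: W_def)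
  finally have "sum \<mu> {u \<in> U. \<forall>y\<in>insert x A. \<not> R y u} \<le> (1 - \<epsilon>) ^ Suc m"
    by (simp only: eq power_Suc)
  moreover have "card (insert x A) \<le> Suc m"
    using A by (simp add: card_insert_if finite_subset[OF _ \<open>finite V\<close>])
  ultimately show ?case
    using A x by (intro exI[of _ "insert x A"]) auto
qed

text \<open>
  The step where transitivity turns almost-domination into domination. Greedily chosen vertices
  miss less than an \<open>\<epsilon>\<close>-fraction of \<open>\<mu>\<close>. If the in-neighbourhood of \<open>v\<close> has at least
  this weight, it contains some \<open>u\<close> that is dominated by a chosen vertex \<open>x\<close>, and then
  \<open>x\<close> dominates \<open>v\<close> through \<open>u\<close>.
\<close>

lemma transitive_bridge:
  fixes w \<mu> :: "'a \<Rightarrow> real"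
  assumes "finite V" "U \<subseteq> V"
    and trans: "\<And>x y z. \<lbrakk>x \<in> V; y \<in> V; z \<in> V; R x y; R y z\<rbrakk> \<Longrightarrow> R x z"
    and w: "\<And>x. x \<in> V \<Longrightarrow> 0 \<le> w x" "sum w V = 1"
    and \<mu>: "\<And>u. u \<in> U \<Longrightarrow> 0 \<le> \<mu> u" "sum \<mu> U = 1"
    and rich: "\<And>u. u \<in> U \<Longrightarrow> \<epsilon> \<le> sum w {x \<in> V. R x u}" and "\<epsilon> \<le> 1"
    and m: "(1 - \<epsilon>) ^ m < \<epsilon>"
  shows "\<exists>A\<subseteq>V. card A \<le> m \<and>
           (\<forall>v\<in>V. \<epsilon> \<le> sum \<mu> {u \<in> U. R u v} \<longrightarrow> (\<exists>x\<in>A. R x v))"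
proof -
  have "finite U"
    using assms(1,2) finite_subset by blast
  obtain A where A: "A \<subseteq> V" "card A \<le> m"
    and rest: "sum \<mu> {u \<in> U. \<forall>x\<in>A. \<not> R x u} \<le> (1 - \<epsilon>) ^ m"
    using greedy_partial_domination[of V U w \<mu> \<epsilon> R m] assms \<open>finite U\<close> by blast
  have "\<exists>x\<in>A. R x v" if v: "v \<in> V" "\<epsilon> \<le> sum \<mu> {u \<in> U. R u v}" for v
  proof (rule ccontr)
    assume none: "\<not> ?thesis"
    have "{u \<in> U. R u v} \<subseteq> {u \<in> U. \<forall>x\<in>A. \<not> R x u}"
    proof safe
      fix u x assume "u \<in> U" "R u v" "x \<in> A" "R x u"
      then have "R x v"
        using trans[of x u v] A(1) \<open>U \<subseteq> V\<close> v(1) by auto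
      then show False
        using none \<open>x \<in> A\<close> by blast
    qed
    then have "sum \<mu> {u \<in> U. R u v} \<le> sum \<mu> {u \<in> U. \<forall>x\<in>A. \<not> R x u}"
      using \<open>finite U\<close> \<mu> by (intro sum_mono2) auto
    then show False
      using v(2) rest m by linarith
  qed
  then show ?thesis
    using A by blast
qed

lemma popular_colour:
  fixes \<mu> :: "'a \<Rightarrow> real"
  assumes "finite U" "finite C" "C \<noteq> {}" and nonneg: "\<And>u. 0 \<le> \<mu> u"
    and big: "1/3 \<le> sum \<mu> {u \<in> U. \<exists>c\<in>C. R c u v}"
  shows "\<exists>c\<in>C. 1 / (3 * card C) \<le> sum \<mu> {u \<in> U. R c u v}"
proof (rule ccontr)
  assume "\<not> ?thesis"
  then have less: "sum \<mu> {u \<in> U. R c u v} < 1 / (3 * card C)" if "c \<in> C" for c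
    using that by auto
  have "sum \<mu> {u \<in> U. \<exists>c\<in>C. R c u v} = (\<Sum>u\<in>U. if \<exists>c\<in>C. R c u v then \<mu> u else 0)"
    using \<open>finite U\<close> by (simp add: sum.inter_filter)
  also have "\<dots> \<le> (\<Sum>u\<in>U. \<Sum>c\<in>C. if R c u v then \<mu> u else 0)"
  proof (rule sum_mono)
    fix u
    show "(if \<exists>c\<in>C. R c u v then \<mu> u else 0) \<le> (\<Sum>c\<in>C. if R c u v then \<mu> u else 0)"
    proof (cases "\<exists>c\<in>C. R c u v")
      case True
      then obtain c where "c \<in> C" "R c u v" by blast
      then show ?thesis
        using member_le_sum[of c C "\<lambda>c. if R c u v then \<mu> u else 0"] nonneg \<open>finite C\<close> by auto
    qed (simp add: sum_nonneg nonneg)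
  qed
  also have "\<dots> = (\<Sum>c\<in>C. \<Sum>u\<in>U. if R c u v then \<mu> u else 0)"
    by (rule sum.swap)
  also have "\<dots> = (\<Sum>c\<in>C. sum \<mu> {u \<in> U. R c u v})"
    using \<open>finite U\<close> by (simp add: sum.inter_filter)
  also have "\<dots> < (\<Sum>c\<in>C. 1 / (3 * card C))"
    using less assms by (intro sum_strict_mono) auto
  also have "\<dots> = 1/3"
    using assms by simp
  finally show False
    using big by simp
qed


text \<open>
  The recursion is that of the next lemma: each of \<open>n\<close> colours costs either \<open>m\<close> greedily
  chosen vertices or one recursive call with one unused colour fewer. The third argument exceeds
  the number of unused colours, so its value 0 never occurs.
\<close>

primrec colour_domination_bound :: "nat \<Rightarrow> nat \<Rightarrow> nat \<Rightarrow> nat" where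
  "colour_domination_bound n m 0 = 0"
| "colour_domination_bound n m (Suc r) = n * (m + colour_domination_bound n m r)"

text \<open>
  Here \<open>R c x v\<close> means that \<open>x\<close> dominates \<open>v\<close> in colour \<open>c\<close>. The set \<open>U\<close> is still to be
  dominated, and \<open>K\<close> consists of the colours used so far: each \<open>c \<in> K\<close> comes with an earlier
  distribution \<open>w c\<close> that gives every vertex of \<open>U\<close> a large in-weight in colour \<open>c\<close>.

  A fractionally dominating distribution \<open>\<mu>\<close> on \<open>U\<close> splits \<open>U\<close> according to a colour
  \<open>c\<close> in which the vertex has large in-weight. If \<open>c\<close> has been used before, the vertices of
  \<open>U\<close> are rich in colour \<open>c\<close> for \<open>w c\<close>, so the previous lemma dominates the whole class
  of \<open>c\<close> at bounded cost. Otherwise \<open>\<mu>\<close> is remembered for \<open>c\<close> and the class is treated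
  recursively. After \<open>card C\<close> steps a colour must repeat.
\<close>

lemma domination_with_remembered_colours:
  fixes V :: "'a set" and C :: "'c set" and w :: "'c \<Rightarrow> 'a \<Rightarrow> real"
  assumes "finite V" "finite C" "C \<noteq> {}"
    and trans: "\<And>c x y z. \<lbrakk>c \<in> C; x \<in> V; y \<in> V; z \<in> V; R c x y; R c y z\<rbrakk> \<Longrightarrow> R c x z"
    and total: "\<And>x y. \<lbrakk>x \<in> V; y \<in> V\<rbrakk> \<Longrightarrow> (\<exists>c\<in>C. R c x y) \<or> (\<exists>c\<in>C. R c y x)"
    and m: "(1 - 1 / (3 * card C)) ^ m < 1 / (3 * card C)"
    and "U \<subseteq> V" "K \<subseteq> C" "card (C - K) < r"
    and "\<And>c x. \<lbrakk>c \<in> K; x \<in> V\<rbrakk> \<Longrightarrow> 0 \<le> w c x" "\<And>c. c \<in> K \<Longrightarrow> sum (w c) V = 1"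
    and "\<And>c u. \<lbrakk>c \<in> K; u \<in> U\<rbrakk> \<Longrightarrow> 1 / (3 * card C) \<le> sum (w c) {x \<in> V. R c x u}"
  shows "\<exists>D\<subseteq>V. card D \<le> colour_domination_bound (card C) m r \<and> (\<forall>v\<in>U. \<exists>x\<in>D. \<exists>c\<in>C. R c x v)"
  using assms(7-)
proof (induction r arbitrary: U K w)
  case 0
  then show ?case by simp
next
  case (Suc r)
  note UV = Suc.prems(1) and KC = Suc.prems(2) and unused = Suc.prems(3)
    and w = Suc.prems(4,5) and rich = Suc.prems(6)
  define \<epsilon> where "\<epsilon> = 1 / (3 * real (card C))"
  show ?case
  proof (cases "U = {}")
    case True
    then show ?thesis by (intro exI[of _ "{}"]) simp
  next
    case False
    have "finite U"
      using UV \<open>finite V\<close> finite_subset by blast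
    have "1 \<le> card C"
      using assms(2,3) by (simp add: Suc_leI card_gt_0_iff)
    then have "\<epsilon> \<le> 1"
      by (simp add: \<epsilon>_def field_simps)
    have "(\<exists>c\<in>C. R c u v) \<or> (\<exists>c\<in>C. R c v u)" if "u \<in> U" "v \<in> U" for u v
      using that total UV by blast
    then obtain \<mu> :: "'a \<Rightarrow> real" where \<mu>: "\<And>u. 0 \<le> \<mu> u" "sum \<mu> U = 1"
      and third: "\<And>v. v \<in> U \<Longrightarrow> 1/3 \<le> sum \<mu> {u \<in> U. \<exists>c\<in>C. R c u v}"
      using fractional_domination[OF \<open>finite U\<close> False, of "\<lambda>u v. \<exists>c\<in>C. R c u v"] by blast
    define Uc where "Uc c = {v \<in> U. \<epsilon> \<le> sum \<mu> {u \<in> U. R c u v}}" for c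
    have "\<exists>A\<subseteq>V. card A \<le> m + colour_domination_bound (card C) m r \<and> (\<forall>v\<in>Uc c. \<exists>x\<in>A. \<exists>c\<in>C. R c x v)"
      if "c \<in> C" for c
    proof (cases "c \<in> K")
      case True
      have "\<exists>A\<subseteq>V. card A \<le> m \<and> (\<forall>v\<in>V. \<epsilon> \<le> sum \<mu> {u \<in> U. R c u v} \<longrightarrow> (\<exists>x\<in>A. R c x v))"
      proof (rule transitive_bridge[OF \<open>finite V\<close> UV, where w = "w c"])
        show "R c x z" if "x \<in> V" "y \<in> V" "z \<in> V" "R c x y" "R c y z" for x y z
          using trans that \<open>c \<in> C\<close> by blast
      qed (use True w \<mu> rich m \<open>\<epsilon> \<le> 1\<close> in \<open>auto simp: \<epsilon>_def\<close>)
      then obtain A where A: "A \<subseteq> V" "card A \<le> m"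
        and dom: "\<And>v. v \<in> V \<Longrightarrow> \<epsilon> \<le> sum \<mu> {u \<in> U. R c u v} \<Longrightarrow> \<exists>x\<in>A. R c x v"
        by blast
      have "\<exists>x\<in>A. \<exists>c\<in>C. R c x v" if "v \<in> Uc c" for v
        using dom[of v] that UV \<open>c \<in> C\<close> unfolding Uc_def by blast
      then show ?thesis
        using A by (intro exI[of _ A]) simp
    next
      case False
      \<comment> \<open>\<open>\<mu>\<close> is only controlled on \<open>U\<close>, while remembered distributions live on \<open>V\<close>.\<close>
      define \<nu> where "\<nu> x = (if x \<in> U then \<mu> x else 0)" for x
      have sum_\<nu>: "sum \<nu> {x \<in> V. P x} = sum \<mu> {x \<in> U. P x}" for P
        using UV \<open>finite V\<close> unfolding \<nu>_def
        by (intro sum.mono_neutral_cong_right) auto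
      have "C - K = insert c (C - insert c K)"
        using False that by auto
      then have "card (C - insert c K) < card (C - K)"
        using \<open>finite C\<close> by (metis Diff_iff card_insert_disjoint finite_Diff insertI1 lessI)
      then have "card (C - insert c K) < r"
        using unused by simp
      then have "\<exists>D\<subseteq>V. card D \<le> colour_domination_bound (card C) m r \<and> (\<forall>v\<in>Uc c. \<exists>x\<in>D. \<exists>c\<in>C. R c x v)"
      proof (rule Suc.IH[where w = "w(c := \<nu>)", rotated 2])
        fix d u assume "d \<in> insert c K" "u \<in> Uc c"
        then show "1 / real (3 * card C) \<le> sum ((w(c := \<nu>)) d) {x \<in> V. R d x u}"
          using rich[of d u] by (auto simp: Uc_def sum_\<nu> \<epsilon>_def)
      qed (use UV KC that w \<mu> sum_\<nu>[of "\<lambda>_. True"] in \<open>auto simp: Uc_def \<nu>_def\<close>)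
      then show ?thesis
        using trans_le_add2 by blast
    qed
    then obtain A where A: "\<And>c. c \<in> C \<Longrightarrow> A c \<subseteq> V"
        "\<And>c. c \<in> C \<Longrightarrow> card (A c) \<le> m + colour_domination_bound (card C) m r"
        "\<And>c v. \<lbrakk>c \<in> C; v \<in> Uc c\<rbrakk> \<Longrightarrow> \<exists>x\<in>A c. \<exists>c\<in>C. R c x v"
      by metis
    have "card (\<Union>c\<in>C. A c) \<le> (\<Sum>c\<in>C. card (A c))"
      using \<open>finite C\<close> by (rule card_UN_le)
    also have "\<dots> \<le> colour_domination_bound (card C) m (Suc r)"
      using sum_bounded_above[of C "\<lambda>c. card (A c)"] A(2) by simp
    finally have "card (\<Union>c\<in>C. A c) \<le> colour_domination_bound (card C) m (Suc r)" .
    moreover have "\<exists>x\<in>(\<Union>c\<in>C. A c). \<exists>c\<in>C. R c x v" if "v \<in> U" for v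
    proof -
      obtain c where "c \<in> C" "v \<in> Uc c"
        using popular_colour[where R = R, OF \<open>finite U\<close> assms(2,3) \<mu>(1) third[OF \<open>v \<in> U\<close>]] \<open>v \<in> U\<close>
        by (auto simp: Uc_def \<epsilon>_def)
      then show ?thesis
        using A(3) by blast
    qed
    ultimately show ?thesis
      using A(1) by (intro exI[of _ "\<Union>c\<in>C. A c"]) blast
  qed
qed

lemma bounded_domination_by_transitive_colours:
  fixes C :: "'c set"
  assumes C: "finite C"
  obtains B where "\<And>(V :: 'a set) R.
    \<lbrakk>finite V;
      \<And>c x y z. \<lbrakk>c \<in> C; x \<in> V; y \<in> V; z \<in> V; R c x y; R c y z\<rbrakk> \<Longrightarrow> R c x z;
      \<And>x y. \<lbrakk>x \<in> V; y \<in> V\<rbrakk> \<Longrightarrow> (\<exists>c\<in>C. R c x y) \<or> (\<exists>c\<in>C. R c y x)\<rbrakk> \<Longrightarrow>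
    \<exists>D\<subseteq>V. card D \<le> B \<and> (\<forall>v\<in>V. \<exists>x\<in>D. \<exists>c\<in>C. R c x v)"
proof (cases "C = {}")
  case True
  show ?thesis
  proof (rule that[of 0])
    fix V :: "'a set" and R :: "'c \<Rightarrow> 'a \<Rightarrow> 'a \<Rightarrow> bool"
    assume "\<And>x y. \<lbrakk>x \<in> V; y \<in> V\<rbrakk> \<Longrightarrow> (\<exists>c\<in>C. R c x y) \<or> (\<exists>c\<in>C. R c y x)"
    then have "V = {}"
      using True by blast
    then show "\<exists>D\<subseteq>V. card D \<le> 0 \<and> (\<forall>v\<in>V. \<exists>x\<in>D. \<exists>c\<in>C. R c x v)"
      by (intro exI[of _ "{}"]) simp
  qed
next
  case False
  then have "0 < card C"
    using C by (simp add: card_gt_0_iff)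
  then obtain m where m: "(1 - 1 / (3 * card C)) ^ m < 1 / (3 * real (card C))"
    using real_arch_pow_inv[of "1 / (3 * real (card C))" "1 - 1 / (3 * real (card C))"] by auto
  show ?thesis
  proof (rule that[of "colour_domination_bound (card C) m (Suc (card C))"])
    fix V :: "'a set" and R
    assume V: "finite V"
      and trans: "\<And>c x y z. \<lbrakk>c \<in> C; x \<in> V; y \<in> V; z \<in> V; R c x y; R c y z\<rbrakk> \<Longrightarrow> R c x z"
      and total: "\<And>x y. \<lbrakk>x \<in> V; y \<in> V\<rbrakk> \<Longrightarrow> (\<exists>c\<in>C. R c x y) \<or> (\<exists>c\<in>C. R c y x)"
    show "\<exists>D\<subseteq>V. card D \<le> colour_domination_bound (card C) m (Suc (card C)) \<and> (\<forall>v\<in>V. \<exists>x\<in>D. \<exists>c\<in>C. R c x v)"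
    proof (rule domination_with_remembered_colours[where K = "{}", OF V C False])
      show "R c x z" if "c \<in> C" "x \<in> V" "y \<in> V" "z \<in> V" "R c x y" "R c y z" for c x y z
        using trans that by blast
      show "(\<exists>c\<in>C. R c x y) \<or> (\<exists>c\<in>C. R c y x)" if "x \<in> V" "y \<in> V" for x y
        using total that .
    qed (use m in simp_all)
  qed
qed

section \<open>Finiteness of the maximum\<close>

lemma dominating_verts: "dominating_set T (pverts T)"
  by (simp add: dominating_set_def)

lemma finite_dominating_cards:
  assumes "finite (pverts T)"
  shows "finite {card D |D. dominating_set T D}"
proof (rule finite_subset)
  show "{card D |D. dominating_set T D} \<subseteq> card ` Pow (pverts T)"
    by (auto simp: dominating_set_def)
qed (use assms in simp)

lemma domination_number_le:
  assumes "finite (pverts T)" "dominating_set T D"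
  shows "domination_number T \<le> card D"
proof -
  have "finite {card D |D. dominating_set T D}"
    using assms(1) by (rule finite_dominating_cards)
  then show ?thesis
    unfolding domination_number_def using assms(2) by (intro Min_le) auto
qed

lemma domination_number_ge:
  assumes "finite (pverts T)" "\<And>D. dominating_set T D \<Longrightarrow> m \<le> card D"
  shows "m \<le> domination_number T"
proof -
  have "finite {card D |D. dominating_set T D}"
    using assms(1) by (rule finite_dominating_cards)
  then show ?thesis
    unfolding domination_number_def using assms(2) dominating_verts
    by (intro Min.boundedI) auto
qed

lemma card_opposite_comparisons:
  assumes "finite I" "\<And>i. i \<in> I \<Longrightarrow> linear_order_on V (P i)" "u \<in> V" "v \<in> V" "u \<noteq> v"
  shows "card {i \<in> I. (v, u) \<in> P i} + card {i \<in> I. (u, v) \<in> P i} = card I"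
proof -
  have "(v, u) \<in> P i \<longleftrightarrow> (u, v) \<notin> P i" if "i \<in> I" for i
    using assms(2)[OF that] assms(3-5)
    by (auto simp: order_on_defs total_on_def antisym_def)
  then have "{i \<in> I. (u, v) \<in> P i} = I - {i \<in> I. (v, u) \<in> P i}"
    by auto
  then show ?thesis
    using \<open>finite I\<close> by (simp add: card_Diff_subset card_mono)
qed

text \<open>
  The colours are the \<open>k\<close>-element sets \<open>S\<close> of orders, with \<open>R S u v\<close> saying that \<open>u\<close>
  is at least \<open>v\<close> in all orders of \<open>S\<close>. These relations are transitive, their union is the
  reflexive closure of the arcs, and their number depends on \<open>k\<close> only.
\<close>

lemma bounded_domination_of_majority_tournaments:
  assumes "k \<ge> 1"
  obtains B where "\<And>T :: 'a pair_pre_digraph. k_majority_tournament k T \<Longrightarrow> domination_number T \<le> B"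
proof -
  define I where "I = {1..2 * k - 1}"
  define C where "C = {S. S \<subseteq> I \<and> card S = k}"
  have "finite I" "card I = 2 * k - 1"
    by (simp_all add: I_def)
  then have "finite C"
    by (simp add: C_def)
  show ?thesis
  proof (rule bounded_domination_by_transitive_colours[OF \<open>finite C\<close>])
    fix B
    assume B: "\<And>(V :: 'a set) R.
    \<lbrakk>finite V;
      \<And>c x y z. \<lbrakk>c \<in> C; x \<in> V; y \<in> V; z \<in> V; R c x y; R c y z\<rbrakk> \<Longrightarrow> R c x z;
      \<And>x y. \<lbrakk>x \<in> V; y \<in> V\<rbrakk> \<Longrightarrow> (\<exists>c\<in>C. R c x y) \<or> (\<exists>c\<in>C. R c y x)\<rbrakk> \<Longrightarrow>
    \<exists>D\<subseteq>V. card D \<le> B \<and> (\<forall>v\<in>V. \<exists>x\<in>D. \<exists>c\<in>C. R c x v)"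
    show thesis
    proof (rule that[of B])
      fix T :: "'a pair_pre_digraph"
      assume T: "k_majority_tournament k T"
      then have "tournament T"
        by (simp add: k_majority_tournament_def)
      then interpret tournament T .
      obtain P where "realizes k P T"
        using T by (auto simp: k_majority_tournament_def)
      then have lin: "\<And>i. i \<in> I \<Longrightarrow> linear_order_on (pverts T) (P i)"
        and arc: "\<And>u v. \<lbrakk>u \<in> pverts T; v \<in> pverts T; u \<noteq> v\<rbrakk> \<Longrightarrow>
          (u, v) \<in> parcs T \<longleftrightarrow> k \<le> card {i \<in> I. (v, u) \<in> P i}"
        by (auto simp: realizes_def I_def)
      define R where "R S u v \<longleftrightarrow> (\<forall>i\<in>S. (v, u) \<in> P i)" for S u v
      have majority: "\<exists>S\<in>C. R S u v" if many: "k \<le> card {i \<in> I. (v, u) \<in> P i}" for u v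
      proof -
        obtain S where "S \<subseteq> {i \<in> I. (v, u) \<in> P i}" "card S = k"
          using obtain_subset_with_card_n[OF many] by blast
        then show ?thesis
          by (intro bexI[of _ S]) (auto simp: R_def C_def)
      qed
      have "\<exists>D\<subseteq>pverts T. card D \<le> B \<and> (\<forall>v\<in>pverts T. \<exists>x\<in>D. \<exists>S\<in>C. R S x v)"
      proof (rule B)
        show "finite (pverts T)"
          by (rule pair_finite_verts)
      next
        fix S x y z assume "S \<in> C" "R S x y" "R S y z"
        then show "R S x z"
          using lin unfolding R_def C_def order_on_defs by (blast dest: transD)
      next
        fix u v assume uv: "u \<in> pverts T" "v \<in> pverts T"
        show "(\<exists>S\<in>C. R S u v) \<or> (\<exists>S\<in>C. R S v u)"
        proof (cases "u = v")
          case True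
          have "(v, v) \<in> P i" if "i \<in> I" for i
            using lin[OF that] uv by (auto simp: order_on_defs refl_on_def)
          then have "{i \<in> I. (v, v) \<in> P i} = I"
            by auto
          then have "k \<le> card {i \<in> I. (v, u) \<in> P i}"
            using True \<open>card I = 2 * k - 1\<close> \<open>k \<ge> 1\<close> by simp
          then show ?thesis
            using majority by blast
        next
          case False
          then have "card {i \<in> I. (v, u) \<in> P i} + card {i \<in> I. (u, v) \<in> P i} = 2 * k - 1"
            using card_opposite_comparisons[where P = P, OF \<open>finite I\<close> lin uv] \<open>card I = 2 * k - 1\<close>
            by simp
          then have "k \<le> card {i \<in> I. (v, u) \<in> P i} \<or> k \<le> card {i \<in> I. (u, v) \<in> P i}"
            by linarith
          then show ?thesis
            using majority by blast
        qed
      qed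
      then obtain D where D: "D \<subseteq> pverts T" "card D \<le> B"
        and dom: "\<And>v. v \<in> pverts T \<Longrightarrow> \<exists>x\<in>D. \<exists>S\<in>C. R S x v"
        by blast
      have "\<exists>x\<in>D. (x, v) \<in> parcs T" if v: "v \<in> pverts T - D" for v
      proof -
        obtain x S where x: "x \<in> D" and S: "S \<in> C" "R S x v"
          using dom v by blast
        have "S \<subseteq> {i \<in> I. (v, x) \<in> P i}"
          using S by (auto simp: C_def R_def)
        then have "k \<le> card {i \<in> I. (v, x) \<in> P i}"
          using S card_mono[of "{i \<in> I. (v, x) \<in> P i}" S] \<open>finite I\<close> by (simp add: C_def)
        then have "(x, v) \<in> parcs T"
          using arc[of x v] x v D(1) by blast
        then show ?thesis
          using x by blast
      qed
      then have "dominating_set T D"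
        using D(1) by (simp add: dominating_set_def)
      then show "domination_number T \<le> B"
        using domination_number_le[OF pair_finite_verts] D(2) by fastforce
    qed
  qed
qed

section \<open>Majority tournaments from opposite pairs of orders\<close>

lemma linear_order_on_inj_key:
  fixes f :: "'a \<Rightarrow> 'b :: linorder"
  assumes "inj_on f V"
  shows "linear_order_on V {(v, u). v \<in> V \<and> u \<in> V \<and> f v \<le> f u}"
  using assms
  by (auto simp: order_on_defs refl_on_def trans_def antisym_def total_on_def inj_on_def)

definition majority_digraph :: "nat \<Rightarrow> (nat \<Rightarrow> 'a rel) \<Rightarrow> 'a set \<Rightarrow> 'a pair_pre_digraph" where
  "majority_digraph k P V =
     \<lparr>pverts = V, parcs = {(u, v) \<in> V \<times> V. u \<noteq> v \<and> k \<le> card {i \<in> {1..2 * k - 1}. (v, u) \<in> P i}}\<rparr>"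

lemma k_majority_tournament_majority_digraph:
  assumes "k \<ge> 1" "finite V" and lin: "\<And>i. i \<in> {1..2 * k - 1} \<Longrightarrow> linear_order_on V (P i)"
  shows "k_majority_tournament k (majority_digraph k P V)"
proof -
  let ?T = "majority_digraph k P V"
  have "tournament ?T"
  proof
    show "finite (parcs ?T)"
      by (rule finite_subset[of _ "V \<times> V"]) (use \<open>finite V\<close> in \<open>auto simp: majority_digraph_def\<close>)
  next
    fix u v assume uv: "u \<in> pverts ?T" "v \<in> pverts ?T" "u \<noteq> v"
    let ?I = "{1..2 * k - 1}"
    have "card {i \<in> ?I. (v, u) \<in> P i} + card {i \<in> ?I. (u, v) \<in> P i} = card ?I"
      using uv lin by (intro card_opposite_comparisons) (auto simp: majority_digraph_def)
    then have "k \<le> card {i \<in> ?I. (v, u) \<in> P i} \<longleftrightarrow> \<not> k \<le> card {i \<in> ?I. (u, v) \<in> P i}"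
      using \<open>k \<ge> 1\<close> by simp linarith
    then show "(u, v) \<in> parcs ?T \<longleftrightarrow> (v, u) \<notin> parcs ?T"
      using uv by (simp add: majority_digraph_def)
  qed (use \<open>finite V\<close> in \<open>auto simp: majority_digraph_def\<close>)
  moreover have "realizes k P ?T"
    using lin by (simp add: realizes_def majority_digraph_def)
  ultimately show ?thesis
    using \<open>k \<ge> 1\<close> by (auto simp: k_majority_tournament_def)
qed

text \<open>
  The orders with indices \<open>2 * i + 1\<close> and \<open>2 * i + 2\<close> form the \<open>i\<close>-th pair. Both compare
  by \<open>\<kappa> i\<close> first, then by \<open>\<sigma> i\<close>, then by the vertex itself, but only the middle comparison
  has the same direction in both. Hence vertices with different \<open>\<kappa> i\<close>, or with the same
  \<open>\<kappa> i\<close> and \<open>\<sigma> i\<close>, are tied in the pair, and among vertices with equal \<open>\<kappa> i\<close> those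
  with \<open>\<sigma> i\<close> win both comparisons against those without.
\<close>

definition paired_key ::
    "(nat \<Rightarrow> nat \<Rightarrow> nat) \<Rightarrow> (nat \<Rightarrow> nat \<Rightarrow> bool) \<Rightarrow> nat \<Rightarrow> nat \<Rightarrow> int \<times> bool \<times> int" where
  "paired_key \<kappa> \<sigma> j v =
     (let i = (j - 1) div 2; sign = if odd j then 1 else -1
      in (sign * int (\<kappa> i v), \<sigma> i v, sign * int v))"

definition paired_orders ::
    "(nat \<Rightarrow> nat \<Rightarrow> nat) \<Rightarrow> (nat \<Rightarrow> nat \<Rightarrow> bool) \<Rightarrow> nat set \<Rightarrow> nat \<Rightarrow> nat rel" where
  "paired_orders \<kappa> \<sigma> V j = {(v, u). v \<in> V \<and> u \<in> V \<and> paired_key \<kappa> \<sigma> j v \<le> paired_key \<kappa> \<sigma> j u}"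

lemma linear_order_on_paired_orders: "linear_order_on V (paired_orders \<kappa> \<sigma> V j)"
  unfolding paired_orders_def
  by (intro linear_order_on_inj_key inj_onI) (auto simp: paired_key_def Let_def split: if_splits)

text \<open>
  As \<open>y\<close> loses no pair, each of the \<open>k - 1\<close> pairs contributes at least one order in which
  \<open>y\<close> is above \<open>x\<close>, and the pair \<open>g\<close> contributes two.
\<close>

lemma paired_orders_majority:
  assumes "x \<in> V" "y \<in> V" and "g < k - 1"
    and gain: "\<kappa> g y = \<kappa> g x" "\<not> \<sigma> g x" "\<sigma> g y"
    and no_loss: "\<And>i. \<kappa> i y = \<kappa> i x \<Longrightarrow> \<sigma> i x \<Longrightarrow> \<sigma> i y"
  shows "k \<le> card {j \<in> {1..2 * k - 1}. (x, y) \<in> paired_orders \<kappa> \<sigma> V j}"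
proof -
  let ?S = "{j \<in> {1..2 * k - 1}. (x, y) \<in> paired_orders \<kappa> \<sigma> V j}"
  \<comment> \<open>\<open>c i\<close> is an order of the \<open>i\<close>-th pair in which \<open>y\<close> is above \<open>x\<close>.\<close>
  define c where "c i = (if (x, y) \<in> paired_orders \<kappa> \<sigma> V (2 * i + 1) then 2 * i + 1 else 2 * i + 2)" for i
  have c_div: "(c i - 1) div 2 = i" for i
    by (simp add: c_def)
  have c: "(x, y) \<in> paired_orders \<kappa> \<sigma> V (c i)" for i
    using no_loss[of i] assms(1,2)
    by (cases "\<kappa> i y = \<kappa> i x") (auto simp: c_def paired_orders_def paired_key_def)
  have both: "(x, y) \<in> paired_orders \<kappa> \<sigma> V (2 * g + 1)" "(x, y) \<in> paired_orders \<kappa> \<sigma> V (2 * g + 2)"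
    using gain assms(1,2) by (auto simp: paired_orders_def paired_key_def)
  let ?A = "c ` ({..<k - 1} - {g})" and ?B = "{2 * g + 1, 2 * g + 2}"
  have "inj c"
    by (rule inj_on_inverseI[where g = "\<lambda>j. (j - 1) div 2"]) (rule c_div)
  then have "card ?A = k - 2"
    using \<open>g < k - 1\<close> by (simp add: card_image inj_on_subset[of c UNIV])
  moreover have "?A \<inter> ?B = {}"
  proof -
    have "(j - 1) div 2 \<noteq> g" if "j \<in> ?A" for j
      using that c_div by auto
    then show ?thesis
      by fastforce
  qed
  ultimately have "card (?A \<union> ?B) = k"
    using \<open>g < k - 1\<close> by (subst card_Un_disjoint) auto
  moreover have "?A \<union> ?B \<subseteq> ?S"
  proof -
    have "c i \<in> {1..2 * k - 1}" if "i < k - 1" for i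
      using that by (auto simp: c_def)
    then show ?thesis
      using c both \<open>g < k - 1\<close> by auto
  qed
  moreover have "finite ?S"
    by simp
  ultimately show ?thesis
    using card_mono by metis
qed

section \<open>A tournament in which small sets do not dominate\<close>

text \<open>
  A vertex consists of \<open>s\<close> independent coordinates. The coordinate \<open>g\<close> has a side, which is a
  truth value, and two labels, with indices \<open>2 * g\<close> and \<open>2 * g + 1\<close>; the side selects which
  of the two labels is active. Label and activity of index \<open>i\<close> are used as \<open>\<kappa> i\<close> and
  \<open>\<sigma> i\<close> of the \<open>i\<close>-th pair of orders, so a vertex wins a pair against another one if their
  labels agree and only its own label is active. There are \<open>s + 1\<close> labels, so that one can
  always avoid the labels of \<open>s\<close> given vertices.
\<close>

definition two_sided_labellings :: "nat \<Rightarrow> ((nat \<Rightarrow> bool) \<times> (nat \<Rightarrow> nat)) set" where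
  "two_sided_labellings s = ({..<s} \<rightarrow>\<^sub>E UNIV) \<times> ({..<2 * s} \<rightarrow>\<^sub>E {..s})"

lemma finite_two_sided_labellings: "finite (two_sided_labellings s)"
  unfolding two_sided_labellings_def by (intro finite_cartesian_product finite_PiE) auto

abbreviation active :: "(nat \<Rightarrow> bool) \<times> (nat \<Rightarrow> nat) \<Rightarrow> nat \<Rightarrow> bool" where
  "active x i \<equiv> fst x (i div 2) = even i"

text \<open>
  Let \<open>h\<close> enumerate \<open>D\<close> by the coordinates. The vertex \<open>y\<close> takes the side opposite to
  \<open>h g\<close> in coordinate \<open>g\<close>. Its active label there is copied from \<open>h g\<close>, for which this
  label is inactive, so \<open>y\<close> wins that pair against \<open>h g\<close>. A pair can only be lost at an
  inactive label, and these are chosen to differ from the labels of all members of \<open>D\<close>.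
\<close>

lemma small_sets_are_beaten:
  assumes "D \<subseteq> two_sided_labellings s" "card D \<le> s"
  shows "\<exists>y\<in>two_sided_labellings s. \<forall>x\<in>D.
           (\<forall>i. snd y i = snd x i \<longrightarrow> active x i \<longrightarrow> active y i) \<and>
           (\<exists>i<2 * s. snd y i = snd x i \<and> \<not> active x i \<and> active y i)"
proof -
  have "finite D"
    using assms(1) finite_two_sided_labellings finite_subset by blast
  obtain b where b: "bij_betw b {0..<card D} D"
    using ex_bij_betw_nat_finite[OF \<open>finite D\<close>] by blast
  obtain z where z: "z \<in> two_sided_labellings s"
  proof
    show "((\<lambda>g\<in>{..<s}. False), (\<lambda>i\<in>{..<2 * s}. 0)) \<in> two_sided_labellings s"
      by (simp add: two_sided_labellings_def)
  qed
  \<comment> \<open>If \<open>D\<close> has fewer than \<open>s\<close> elements, the remaining coordinates serve an arbitrary vertex.\<close>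
  define h where "h g = (if g < card D then b g else z)" for g
  have h: "h g \<in> two_sided_labellings s" for g
    using bij_betw_apply[OF b, of g] z subsetD[OF assms(1), of "b g"] by (simp add: h_def)
  have cover: "\<exists>g<s. h g = x" if "x \<in> D" for x
  proof -
    have "x \<in> b ` {0..<card D}"
      using that by (simp only: bij_betw_imp_surj_on[OF b])
    then obtain g where g: "x = b g" "g < card D"
      by (elim imageE) simp
    then have "g < s"
      using assms(2) by linarith
    then show ?thesis
      using g by (intro exI[of _ g]) (simp add: h_def)
  qed
  have "\<exists>f\<le>s. \<forall>x\<in>D. snd x i \<noteq> f" for i
  proof -
    have "card ((\<lambda>x. snd x i) ` D) < card {..s}"
      using card_image_le[OF \<open>finite D\<close>, of "\<lambda>x. snd x i"] assms(2) by simp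
    then have "\<not> {..s} \<subseteq> (\<lambda>x. snd x i) ` D"
      using card_mono[of "(\<lambda>x. snd x i) ` D" "{..s}"] \<open>finite D\<close> by auto
    then obtain f where "f \<le> s" "f \<notin> (\<lambda>x. snd x i) ` D"
      by auto
    then show ?thesis
      by (intro exI[of _ f]) auto
  qed
  then obtain f where f: "\<And>i. f i \<le> s" "\<And>i x. x \<in> D \<Longrightarrow> snd x i \<noteq> f i"
    by metis
  define side where "side = (\<lambda>g\<in>{..<s}. \<not> fst (h g) g)"
  define label where
    "label = (\<lambda>i\<in>{..<2 * s}. if side (i div 2) = even i then snd (h (i div 2)) i else f i)"
  have "snd (h g) i \<le> s" if "i < 2 * s" for g i
    using h[of g] that by (auto simp: two_sided_labellings_def)
  then have "(side, label) \<in> two_sided_labellings s"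
    using f(1) by (auto simp: two_sided_labellings_def side_def label_def)
  moreover have "active (side, label) i" if "x \<in> D" "label i = snd x i" "active x i" for x i
  proof (cases "i < 2 * s")
    case True
    then show ?thesis
      using f(2)[OF \<open>x \<in> D\<close>, of i] that(2) by (auto simp: label_def split: if_splits)
  next
    case False
    \<comment> \<open>Outside the index range, all vertices have the same default side.\<close>
    then have "side (i div 2) = fst x (i div 2)"
      using \<open>x \<in> D\<close> assms(1) by (auto simp: side_def two_sided_labellings_def PiE_def extensional_def)
    then show ?thesis
      using that(3) by simp
  qed
  moreover have "\<exists>i<2 * s. label i = snd x i \<and> \<not> active x i \<and> active (side, label) i"
    if "x \<in> D" for x
  proof -
    obtain g where g: "g < s" "h g = x"
      using cover[OF \<open>x \<in> D\<close>] by blast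
    define i where "i = (if side g then 2 * g else 2 * g + 1)"
    have "i div 2 = g" "even i = side g" "i < 2 * s"
      using g(1) by (auto simp: i_def)
    then show ?thesis
      using g by (intro exI[of _ i]) (auto simp: label_def side_def)
  qed
  ultimately show ?thesis
    by (intro bexI[of _ "(side, label)"]) auto
qed

text \<open>
  The vertices are numbered by \<open>e\<close>. The \<open>2 * k - 1\<close> orders contain \<open>k - 1 \<ge> 2 * s\<close> pairs;
  in the pairs with index at least \<open>2 * s\<close> all vertices agree in label and activity, so these
  pairs only produce ties.
\<close>

lemma majority_tournament_with_large_domination_number:
  assumes "2 * s < k"
  obtains T :: "nat pair_pre_digraph" where "k_majority_tournament k T" "s < domination_number T"
proof -
  obtain e where e: "bij_betw e {0..<card (two_sided_labellings s)} (two_sided_labellings s)"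
    using ex_bij_betw_nat_finite[OF finite_two_sided_labellings] by blast
  define V where "V = {0..<card (two_sided_labellings s)}"
  define P where "P = paired_orders (\<lambda>i v. snd (e v) i) (\<lambda>i v. active (e v) i) V"
  define T where "T = majority_digraph k P V"
  have "finite V"
    by (simp add: V_def)
  have lin: "linear_order_on V (P j)" for j
    unfolding P_def by (rule linear_order_on_paired_orders)
  have T: "k_majority_tournament k T"
    unfolding T_def using assms \<open>finite V\<close> lin
    by (intro k_majority_tournament_majority_digraph) auto
  then have "tournament T"
    by (simp add: k_majority_tournament_def)
  have verts: "pverts T = V"
    by (simp add: T_def majority_digraph_def)
  have "s < card D" if D: "dominating_set T D" for D
  proof (rule ccontr)
    assume "\<not> s < card D"
    have "D \<subseteq> V"
      using D verts by (simp add: dominating_set_def)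
    then have "finite D"
      using \<open>finite V\<close> finite_subset by blast
    have "card (e ` D) \<le> s"
      using card_image_le[OF \<open>finite D\<close>, of e] \<open>\<not> s < card D\<close> by linarith
    moreover have "e ` D \<subseteq> two_sided_labellings s"
      using e \<open>D \<subseteq> V\<close> by (auto simp: bij_betw_def V_def)
    ultimately obtain w where w: "w \<in> two_sided_labellings s"
      and no_loss: "\<And>x i. \<lbrakk>x \<in> D; snd w i = snd (e x) i; active (e x) i\<rbrakk> \<Longrightarrow> active w i"
      and gain: "\<And>x. x \<in> D \<Longrightarrow> \<exists>i<2 * s. snd w i = snd (e x) i \<and> \<not> active (e x) i \<and> active w i"
      using small_sets_are_beaten[of "e ` D" s] by (metis imageI)
    obtain y where y: "y \<in> V" "e y = w"
      using e w by (metis V_def bij_betw_imp_surj_on imageE)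
    have "y \<notin> D"
      using gain y(2) by blast
    then obtain x where x: "x \<in> D" and "(x, y) \<in> parcs T"
      using D y(1) verts by (auto simp: dominating_set_def)
    have "x \<in> V" "x \<noteq> y"
      using x \<open>D \<subseteq> V\<close> \<open>y \<notin> D\<close> by auto
    obtain i where i: "i < 2 * s" "snd w i = snd (e x) i" "\<not> active (e x) i" "active w i"
      using gain[OF x] by blast
    have "k \<le> card {j \<in> {1..2 * k - 1}. (x, y) \<in> P j}"
      unfolding P_def
    proof (rule paired_orders_majority[OF \<open>x \<in> V\<close> \<open>y \<in> V\<close>])
      show "i < k - 1"
        using i(1) assms by linarith
    qed (use i no_loss[OF x] y(2) in auto)
    then have "(y, x) \<in> parcs T"
      using \<open>x \<in> V\<close> y(1) \<open>x \<noteq> y\<close> by (simp add: T_def majority_digraph_def)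
    then show False
      using tournament.exactly_one_arc[OF \<open>tournament T\<close>, of x y] verts \<open>x \<in> V\<close> y(1) \<open>x \<noteq> y\<close>
        \<open>(x, y) \<in> parcs T\<close> by simp
  qed
  then have "Suc s \<le> domination_number T"
    using \<open>finite V\<close> verts by (intro domination_number_ge) (auto simp: Suc_le_eq)
  then show ?thesis
    using that T by (simp add: Suc_le_eq)
qed

section \<open>The lower bound\<close>

text \<open>
  The maximum in the definition of \<open>F k\<close> is taken over a bounded set of numbers, so every
  \<open>k\<close>-majority tournament gives a lower bound.
\<close>

lemma F_lower_bound:
  assumes "k \<ge> 1"
  shows "(k + 1) div 2 \<le> F k"
proof -
  obtain T :: "nat pair_pre_digraph"
    where T: "k_majority_tournament k T" "(k - 1) div 2 < domination_number T"
  proof (rule majority_tournament_with_large_domination_number)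
    show "2 * ((k - 1) div 2) < k"
      using assms by linarith
  qed
  obtain B where B: "\<And>T :: nat pair_pre_digraph. k_majority_tournament k T \<Longrightarrow> domination_number T \<le> B"
    using bounded_domination_of_majority_tournaments[OF assms] by blast
  let ?N = "{domination_number T |T :: nat pair_pre_digraph. k_majority_tournament k T}"
  have "?N \<subseteq> {..B}"
    using B by auto
  then have "finite ?N"
    using finite_subset by blast
  then have "domination_number T \<le> F k"
    unfolding F_def using T(1) by (intro Max_ge) auto
  then show ?thesis
    using T(2) assms by linarith
qed

theorem corollary2:
  shows "(\<forall>k::nat. k \<ge> 3 \<longrightarrow> int (F k) \<ge> \<lfloor>(real k + 1) / 2\<rfloor>) \<and>
         liminf (\<lambda>k. ereal (real (F k) / real k)) \<ge> ereal (1 / 2)"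
proof
  have "\<lfloor>(real k + 1) / 2\<rfloor> = int ((k + 1) div 2)" for k :: nat
    using floor_divide_of_nat_eq[of "k + 1" 2, where 'a = real] by (simp add: add.commute)
  then show "\<forall>k::nat. k \<ge> 3 \<longrightarrow> int (F k) \<ge> \<lfloor>(real k + 1) / 2\<rfloor>"
    using F_lower_bound by simp
  have "ereal (1 / 2) \<le> ereal (real (F k) / real k)" if "k \<ge> 1" for k
  proof -
    have "k \<le> 2 * F k"
      using F_lower_bound[OF that] by linarith
    then have "real k \<le> 2 * real (F k)"
      by linarith
    then show ?thesis
      using that by (simp add: field_simps)
  qed
  then show "liminf (\<lambda>k. ereal (real (F k) / real k)) \<ge> ereal (1 / 2)"
    by (intro Liminf_bounded eventually_sequentiallyI[of 1])
qed

end
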